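(* There is a constant $K>0$ such that, for infinitely many positive integers $n$, there exists a ZDD $G$ with $n$ nodes whose corresponding top ZDD has at most $K\log n$ vertices. (That is, there exist ZDDs with $n$ nodes, $n\to\infty$, to which the corresponding top ZDD has $O(\log n)$ vertices.) Here the vertices of the top ZDD are the vertices of its top DAG $\mathcal{T}D$.
   Context: **ZDD.** Let $C=\{1,\dots,c\}$. An (ordered) ZDD is a finite directed acyclic graph $G$ with a root node from which all nodes are reachable. It has branching nodes and terminal nodes. The terminal nodes are $\bot$ and $\top$ and have no outgoing edges. Each branching node $v$ has a label $\ell(v)\in\{1,\dots,c\}$ and exactly two outgoing edges, a $0$-edge to $\mathit{zero}(v)$ and a $1$-edge to $\mathit{one}(v)$ (possibly with the same target). By convention $\ell(\bot)=\ell(\top)=c+1$, and $\ell(v)<\ell(\mathit{zero}(v))$, $\ell(v)<\ell(\mathit{one}(v))$ for all branching nodes $v$. The family represented by a node is $\mathcal{F}_\top=\{\emptyset\}$, $\mathcal{F}_\bot=\emptyset$, $\mathcal{F}_v=\{S\cup\{\ell(v)\}\mid S\in\mathcal{F}_{\mathit{one}(v)}\}\cup\mathcal{F}_{\mathit{zero}(v)}$; $G$ represents $\mathcal{F}_{\text{root}}$. Each edge $(u,v)$ carries as label the pair (type $0$ or $1$, $\ell(u)-\ell(v)$) if $v$ is branching, and (type $0$ or $1$, $\bot$ or $\top$) if $v$ is terminal. It is assumed that $G$ has at least two branching nodes. **Clusters and top trees.** Let $T$ be a rooted ordered tree with edges directed away from the root. A cluster is a connected set $F$ of nodes of $T$;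 its node closest to the root is its top boundary node. At most one node of $F$ has directed edges to nodes outside $F$; if there is such a node, it is the bottom boundary node. (A cluster carries a set of edges of $T$; for a cluster formed by horizontal merging of some of the child edges of its top boundary node, the other child edges of that top node are disregarded in this condition.) Two clusters can be merged (union) *vertically* if the top boundary node of one is the bottom boundary node of the other and no edges leave the common node to outside the two clusters; they can be merged *horizontally* if they have the same top boundary node and at least one of them has no bottom boundary node. A top tree $\mathcal{T}$ of $T$ is a binary tree whose leaves correspond to the single-edge clusters of $T$, whose internal vertices correspond to the merge of the clusters of their two children (for a vertical merge the left child is the upper cluster; for a horizontal merge the left child is the cluster coming first in the order of children), and whose root corresponds to all of $T$. A leaf of $\mathcal{T}$ is labeled by the label of its edge; an internal vertex is labeled $\mathrm{V}$ for a vertical merge, $\mathrm{H_L}$ (resp. $\mathrm{H_R}$) for a horizontal merge in which the left (resp. right) child has a bottom boundary node, and $\mathrm{H_L}$, say, if neither has. **Greedy construction of $\mathcal{T}$ (Bille et al.).** Maintain an ordered tree $\widetilde T$, initially $T$, each edge of which represents a cluster (initially single edges). Repeat rounds until $\widetilde T$ is a single edge. In each round, with respect to the tree $\widetilde T$ at the start of the round: (Step 1, horizontal) for each node $v$ with children $v_1,\dots,v_k$, $k\ge 2$, for $i=1,\dots,\lfloor k/2\rfloor$ merge the edges $(v,v_{2i-1})$ and $(v,v_{2i})$ if $v_{2i-1}$ or $v_{2i}$ is a leaf; if $k$ is odd, $v_k$ is a leaf and both $v_{k-2},v_{k-1}$ are non-leaves, also merge $(v,v_{k-1})$ and $(v,v_k)$.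 (Step 2, vertical) for each maximal path $v_1,\dots,v_p$ where $v_{i+1}$ is the parent of $v_i$ and $v_2,\dots,v_{p-1}$ have a single child: if $p$ is even merge the pairs of edges $\{(v_1,v_2),(v_2,v_3)\},\{(v_3,v_4),(v_4,v_5)\},\dots,\{(v_{p-3},v_{p-2}),(v_{p-2},v_{p-1})\}$; if $p$ is odd merge $\{(v_1,v_2),(v_2,v_3)\},\dots,\{(v_{p-4},v_{p-3}),(v_{p-3},v_{p-2})\}$ and, if $(v_{p-1},v_p)$ was not merged in Step 1, also $\{(v_{p-2},v_{p-1}),(v_{p-1},v_p)\}$. Each merge of two edges replaces them in $\widetilde T$ by one edge and creates a vertex of $\mathcal{T}$ whose children are the vertices of the two merged clusters. **The top ZDD of a ZDD $G$.** 1. A depth-first traversal from the root of $G$ (at each node the $0$-edge comes before the $1$-edge; both kinds of edges may become tree edges; terminals are not included) yields a spanning tree $T$ of the branching nodes. Nodes of $T$ are identified with their preorders (starting at $1$). Edges of $G$ not in $T$ are called complement edges. 2. $T$, as an edge-labeled tree, is converted to a top tree $\mathcal{T}$ by the greedy construction. 3. Each complement edge $(u,v)$ is stored in a vertex of $\mathcal{T}$. If $u$ is not the root of $T$, let $a$ be the leaf of $\mathcal{T}$ for the edge of $T$ from the parent of $u$ to $u$. If $v$ is a terminal, the triple ($(u,v)$, type $0$/$1$, $\bot$/$\top$) is stored in $a$. If $v$ is a branching node, let $b$ be the leaf of $\mathcal{T}$ for the edge of $T$ from the parent of $v$ to $v$; the triple ($(u,v)$, type $0$/$1$, $\ell(u)-\ell(v)$)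 is stored in $\mathrm{lca}(a,b)$ in $\mathcal{T}$. In these triples $u$ and (if branching) $v$ are given by their local preorders inside the cluster of the vertex in which the triple is stored. If $u$ is the root of $T$, the complement edge is stored in the root of $\mathcal{T}$. 4. The top DAG $\mathcal{T}D$ is obtained from $\mathcal{T}$ by DAG compression: two vertices of $\mathcal{T}$ are identified iff the subtrees of $\mathcal{T}$ rooted at them are identical as ordered labeled trees, including the complement-edge triples stored in their vertices. Complement edges which do not appear in multiple clusters (i.e. stored in a vertex of $\mathcal{T}D$ that arises from only one vertex of $\mathcal{T}$) are moved to the root. The top ZDD is $\mathcal{T}D$ together with the stored labels and complement edges. *)

theory Defs
  imports Complex_Main "HOL-Library.While_Combinator"
begin

datatype 'a node = Bot | Top | Branch 'a

datatype etype = Zero | One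

text \<open>Both terminals are nodes of every diagram. Since terminals have no outgoing edges and
  all nodes must be reachable, the root is a branching node.\<close>

record 'a zdd =
  num_labels :: nat
  branching :: "'a set"
  zroot :: 'a
  lab :: "'a \<Rightarrow> nat"
  zero_child :: "'a \<Rightarrow> 'a node"
  one_child :: "'a \<Rightarrow> 'a node"

text \<open>As \<open>zero_child v\<close> and \<open>one_child v\<close> may coincide, an edge is given by its source and type.\<close>

type_synonym 'a edge = "'a \<times> etype"

fun target :: "'a zdd \<Rightarrow> 'a edge \<Rightarrow> 'a node" where
  "target G (v, Zero) = zero_child G v"
| "target G (v, One) = one_child G v"

definition nodes :: "'a zdd \<Rightarrow> 'a node set" where
  "nodes G = {Bot, Top} \<union> Branch ` branching G"

definition edges :: "'a zdd \<Rightarrow> 'a edge set" where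
  "edges G = branching G \<times> UNIV"

definition arcs :: "'a zdd \<Rightarrow> ('a node \<times> 'a node) set" where
  "arcs G = (\<lambda>e. (Branch (fst e), target G e)) ` edges G"

fun level :: "'a zdd \<Rightarrow> 'a node \<Rightarrow> nat" where
  "level G (Branch v) = lab G v"
| "level G _ = num_labels G + 1"

definition is_zdd :: "'a zdd \<Rightarrow> bool" where
  "is_zdd G \<longleftrightarrow>
     finite (branching G) \<and> zroot G \<in> branching G \<and>
     (\<forall>v \<in> branching G. lab G v \<in> {1..num_labels G}) \<and>
     (\<forall>e \<in> edges G. target G e \<in> nodes G \<and> lab G (fst e) < level G (target G e)) \<and>
     (\<forall>x \<in> nodes G. (Branch (zroot G), x) \<in> (arcs G)\<^sup>*)"

text \<open>The second component of an edge label is \<open>Branch (\<ell>(u) - \<ell>(v))\<close> if the target \<open>v\<close> is a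
  branching node, and the terminal itself otherwise.\<close>

definition edge_label :: "'a zdd \<Rightarrow> 'a edge \<Rightarrow> etype \<times> int node" where
  "edge_label G e =
     (snd e, map_node (\<lambda>v. int (lab G (fst e)) - int (lab G v)) (target G e))"

datatype (tree_nodes: 'v, tree_edges: 'e) otree = ONode 'v "('e \<times> ('v, 'e) otree) list"

text \<open>\<open>follow G rec e Y\<close> inspects the edge \<open>e\<close> when the set of nodes visited so far is \<open>Y\<close>; it
  yields the list of at most one child edge contributed by \<open>e\<close>, and the new set of visited nodes.\<close>

definition follow ::
  "'a zdd \<Rightarrow> ('a \<Rightarrow> 'a set \<Rightarrow> ('a, 'a edge) otree \<times> 'a set) \<Rightarrow> 'a edge \<Rightarrow> 'a set \<Rightarrow>
   ('a edge \<times> ('a, 'a edge) otree) list \<times> 'a set" where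
  "follow G rec e Y =
     (case target G e of
        Branch w \<Rightarrow> if w \<in> Y then ([], Y) else (let (t, Z) = rec w Y in ([(e, t)], Z))
      | _ \<Rightarrow> ([], Y))"

text \<open>The number argument bounds the recursion depth. Labels in \<open>{1..c}\<close> increase strictly along
  edges, so that the bound \<open>c\<close> used in \<open>spanning_tree\<close> is never exhausted.\<close>

primrec dfs :: "'a zdd \<Rightarrow> nat \<Rightarrow> 'a \<Rightarrow> 'a set \<Rightarrow> ('a, 'a edge) otree \<times> 'a set" where
  "dfs G 0 v X = (ONode v [], insert v X)"
| "dfs G (Suc d) v X =
     (let (cs0, X0) = follow G (dfs G d) (v, Zero) (insert v X);
          (cs1, X1) = follow G (dfs G d) (v, One) X0
      in (ONode v (cs0 @ cs1), X1))"

definition spanning_tree :: "'a zdd \<Rightarrow> ('a, 'a edge) otree" where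
  "spanning_tree G = fst (dfs G (num_labels G) (zroot G) {})"

fun preorder :: "('v, 'e) otree \<Rightarrow> 'v list" where
  "preorder (ONode v cs) = v # concat (map (\<lambda>(e, t). preorder t) cs)"

definition complement_edges :: "'a zdd \<Rightarrow> 'a edge set" where
  "complement_edges G = edges G - tree_edges (spanning_tree G)"

definition parent_edge :: "'a zdd \<Rightarrow> 'a \<Rightarrow> 'a edge" where
  "parent_edge G v = (THE e. e \<in> tree_edges (spanning_tree G) \<and> target G e = Branch v)"

datatype merge = V | HL | HR

datatype (leaves: 'l, 'i) ttree = Leaf 'l | Node 'i "('l, 'i) ttree" "('l, 'i) ttree"

text \<open>An edge of the tree being contracted carries its cluster, given as a top tree.\<close>

type_synonym ('v, 'l) ctree = "('v, ('l, merge) ttree) otree"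
type_synonym ('v, 'l) cedge = "('l, merge) ttree \<times> ('v, 'l) ctree"

fun is_leaf :: "('v, 'e) otree \<Rightarrow> bool" where
  "is_leaf (ONode v cs) = (cs = [])"

text \<open>The child edges of a node, split into the pairs merged in the horizontal step and
  singletons. The first clause applies to the last three children when their number is odd.\<close>

fun hblocks :: "('e \<times> ('v, 'e) otree) list \<Rightarrow> ('e \<times> ('v, 'e) otree) list list" where
  "hblocks [a, b, c] =
     (if is_leaf (snd a) \<or> is_leaf (snd b) then [[a, b], [c]]
      else if is_leaf (snd c) then [[a], [b, c]]
      else [[a], [b], [c]])"
| "hblocks (a # b # cs) =
     (if is_leaf (snd a) \<or> is_leaf (snd b) then [a, b] # hblocks cs
      else [a] # [b] # hblocks cs)"
| "hblocks [a] = [[a]]"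
| "hblocks [] = []"

text \<open>At least one of two merged edges ends in a leaf; the merged edge ends in the other child,
  i.e. in the bottom boundary node of the cluster if there is one.\<close>

fun hmerge :: "('v, 'l) cedge list \<Rightarrow> ('v, 'l) cedge" where
  "hmerge [(e1, t1), (e2, t2)] =
     (if is_leaf t2 then (Node HL e1 e2, t1) else (Node HR e1 e2, t2))"
| "hmerge xs = hd xs"

text \<open>Number of edges on the maximal path descending from a node through nodes with a single
  child.\<close>

fun chain :: "('v, 'e) otree \<Rightarrow> nat" where
  "chain (ONode v [(e, t)]) = Suc (chain t)"
| "chain (ONode v cs) = 0"

fun tree_size :: "('v, 'e) otree \<Rightarrow> nat" where
  "tree_size (ONode v cs) = Suc (sum_list (map (\<lambda>(e, t). tree_size t) cs))"

lemma hblocks_subset: "b \<in> set (hblocks cs) \<Longrightarrow> set b \<subseteq> set cs"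
  by (induction cs rule: hblocks.induct) (auto split: if_splits)

lemma tree_size_child: "(e, t) \<in> set cs \<Longrightarrow> tree_size t < tree_size (ONode v cs)"
  by (induction cs) (auto split: prod.splits)

text \<open>All decisions of a round refer to the tree at its beginning, so both steps are done in one
  descent. \<open>vstep m (e, t)\<close> treats a child edge \<open>e\<close> with the tree \<open>t\<close> below it, where \<open>m\<close> tells
  whether \<open>e\<close> is merged horizontally. If \<open>e\<close> is the top edge of a maximal path with \<open>p\<close> nodes, then
  \<open>chain t + 1 = p - 1\<close>. Pairs are formed from the bottom, hence an edge is the
  upper edge of a pair iff the number of path edges below it is odd; the topmost pair is
  formed only if its upper edge is not merged horizontally. All other edges of a path are
  only children and never merged horizontally.\<close>

function (sequential)
  greedy_round :: "('v, 'l) ctree \<Rightarrow> ('v, 'l) ctree" and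
  vstep :: "bool \<Rightarrow> ('v, 'l) cedge \<Rightarrow> ('v, 'l) cedge" where
  "greedy_round (ONode v cs) =
     ONode v (map (\<lambda>b. hmerge (map (vstep (length b = 2)) b)) (hblocks cs))"
| "vstep m (e, ONode u [(e', t')]) =
     (if \<not> m \<and> odd (chain (ONode u [(e', t')])) then (Node V e e', greedy_round t')
      else (e, greedy_round (ONode u [(e', t')])))"
| "vstep m (e, t) = (e, greedy_round t)"
  by pat_completeness auto

termination
proof (relation "measure (case_sum (\<lambda>t. 2 * tree_size t) (\<lambda>(m, e, t). 2 * tree_size t + 1))",
    goal_cases)
  case (2 v cs b x)
  obtain e t where x: "x = (e, t)" by (cases x)
  have "(e, t) \<in> set cs" using 2 x hblocks_subset by blast
  from tree_size_child[OF this, of v] show ?case using x by simp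
qed auto

fun single_edge :: "('v, 'e) otree \<Rightarrow> bool" where
  "single_edge (ONode v [(e, t)]) = is_leaf t"
| "single_edge (ONode v cs) = False"

fun first_edge :: "('v, 'e) otree \<Rightarrow> 'e" where
  "first_edge (ONode v cs) = fst (hd cs)"

definition greedy_top_tree :: "('v, 'e) otree \<Rightarrow> ('e, merge) ttree" where
  "greedy_top_tree T =
     first_edge (while (\<lambda>t. \<not> single_edge t) greedy_round (map_otree id Leaf T))"

text \<open>The leaves of the top tree are distinct edges of \<open>G\<close>. Therefore different vertices of it have
  different subtrees, and a vertex is represented by the subtree rooted at it.\<close>

type_synonym 'a vertex = "('a edge, merge) ttree"

definition top_tree :: "'a zdd \<Rightarrow> 'a vertex" where
  "top_tree G = greedy_top_tree (spanning_tree G)"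

fun subtrees :: "('l, 'i) ttree \<Rightarrow> ('l, 'i) ttree set" where
  "subtrees (Leaf x) = {Leaf x}"
| "subtrees (Node m l r) = insert (Node m l r) (subtrees l \<union> subtrees r)"

fun lca :: "('l, 'i) ttree \<Rightarrow> 'l \<Rightarrow> 'l \<Rightarrow> ('l, 'i) ttree" where
  "lca (Leaf x) a b = Leaf x"
| "lca (Node m l r) a b =
     (if {a, b} \<subseteq> leaves l then lca l a b
      else if {a, b} \<subseteq> leaves r then lca r a b
      else Node m l r)"

definition cluster_nodes :: "'a zdd \<Rightarrow> 'a vertex \<Rightarrow> 'a set" where
  "cluster_nodes G s = {v. \<exists>e \<in> leaves s. v = fst e \<or> Branch v = target G e}"

text \<open>Global preorder ranks agree in order with the preorder inside a cluster.\<close>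

definition local_preorder :: "'a zdd \<Rightarrow> 'a vertex \<Rightarrow> 'a \<Rightarrow> nat" where
  "local_preorder G s v =
     length (filter (\<lambda>w. w \<in> cluster_nodes G s) (takeWhile (\<lambda>w. w \<noteq> v) (preorder (spanning_tree G)))) + 1"

type_synonym triple = "(nat \<times> nat node) \<times> etype \<times> int node"

definition triple :: "'a zdd \<Rightarrow> 'a vertex \<Rightarrow> 'a edge \<Rightarrow> triple" where
  "triple G s e =
     ((local_preorder G s (fst e), map_node (local_preorder G s) (target G e)), edge_label G e)"

definition store_at :: "'a zdd \<Rightarrow> 'a edge \<Rightarrow> 'a vertex" where
  "store_at G e =
     (if fst e = zroot G then top_tree G
      else case target G e of
          Branch v \<Rightarrow> lca (top_tree G) (parent_edge G (fst e)) (parent_edge G v)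
        | _ \<Rightarrow> Leaf (parent_edge G (fst e)))"

definition stored :: "'a zdd \<Rightarrow> 'a vertex \<Rightarrow> triple set" where
  "stored G s = triple G s ` {e \<in> complement_edges G. store_at G e = s}"

fun labelled ::
  "'a zdd \<Rightarrow> 'a vertex \<Rightarrow> ((etype \<times> int node) \<times> triple set, merge \<times> triple set) ttree" where
  "labelled G (Leaf e) = Leaf (edge_label G e, stored G (Leaf e))"
| "labelled G (Node m l r) = Node (m, stored G (Node m l r)) (labelled G l) (labelled G r)"

text \<open>The vertices of the top DAG are the classes of identified vertices of the top tree.\<close>

definition dag_rel :: "'a zdd \<Rightarrow> ('a vertex \<times> 'a vertex) set" where
  "dag_rel G =
     {(s, t). s \<in> subtrees (top_tree G) \<and> t \<in> subtrees (top_tree G) \<and> labelled G s = labelled G t}"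

definition dag_class :: "'a zdd \<Rightarrow> 'a vertex \<Rightarrow> 'a vertex set" where
  "dag_class G s = dag_rel G `` {s}"

datatype vlabel = EdgeLabel "etype \<times> int node" | MergeLabel merge

record 'v top_zdd =
  vertices :: "'v set"
  top_root :: 'v
  children :: "'v \<Rightarrow> 'v list"
  vertex_label :: "'v \<Rightarrow> vlabel"
  complement :: "'v \<Rightarrow> triple set"

text \<open>The complement edges stored in a class with a single element are moved to the root,
  where they are given by preorders inside the whole tree.\<close>

definition top_zdd_of :: "'a zdd \<Rightarrow> 'a vertex set top_zdd" where
  "top_zdd_of G =
     \<lparr> vertices = subtrees (top_tree G) // dag_rel G,
       top_root = dag_class G (top_tree G),
       children = (\<lambda>X. case (SOME s. s \<in> X) of
           Leaf e \<Rightarrow> []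
         | Node m l r \<Rightarrow> [dag_class G l, dag_class G r]),
       vertex_label = (\<lambda>X. case (SOME s. s \<in> X) of
           Leaf e \<Rightarrow> EdgeLabel (edge_label G e)
         | Node m l r \<Rightarrow> MergeLabel m),
       complement = (\<lambda>X.
         if X = dag_class G (top_tree G) then
           triple G (top_tree G) `
             {e \<in> complement_edges G. card (dag_class G (store_at G e)) = 1}
         else if card X = 1 then {}
         else stored G (SOME s. s \<in> X)) \<rparr>"

end

theory Submission
  imports Defs
begin

text \<open>A ZDD for a single set \<open>{1..N + 1}\<close> is a path of \<open>N + 1\<close> branching nodes whose \<open>1\<close>-edges
  form the spanning tree. For \<open>N = 2 ^ k\<close> the greedy construction turns it into the perfect binary
  tree of height \<open>k\<close>. The complement edges at non-root nodes end in terminals and hence are stored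
  in leaves, so that all leaves but the last one look alike. Therefore each height contributes at
  most two classes of vertices: the subtrees with and without the last leaf.\<close>

section \<open>The path ZDD\<close>

definition path_zdd :: "nat \<Rightarrow> nat zdd" where
  "path_zdd N = \<lparr> num_labels = Suc N, branching = {..N}, zroot = 0, lab = Suc,
     zero_child = (\<lambda>v. Bot),
     one_child = (\<lambda>v. if v < N then Branch (Suc v) else Top) \<rparr>"

lemma path_zdd_sel [simp]:
  "num_labels (path_zdd N) = Suc N" "branching (path_zdd N) = {..N}"
  "zroot (path_zdd N) = 0" "lab (path_zdd N) = Suc"
  "zero_child (path_zdd N) v = Bot"
  "one_child (path_zdd N) v = (if v < N then Branch (Suc v) else Top)"
  by (simp_all add: path_zdd_def)

lemma target_path_zdd_eq_Branch:
  "target (path_zdd N) e = Branch w \<longleftrightarrow> (\<exists>v<N. e = (v, One) \<and> w = Suc v)"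
  by (cases "(path_zdd N, e)" rule: target.cases) auto

lemma arcs_path_zddI:
  "v \<le> N \<Longrightarrow> (Branch v, target (path_zdd N) (v, b)) \<in> arcs (path_zdd N)"
  unfolding arcs_def edges_def by (rule image_eqI[of _ _ "(v, b)"]) auto

lemma reachable_path_zdd:
  "v \<le> N \<Longrightarrow> (Branch 0, Branch v) \<in> (arcs (path_zdd N))\<^sup>*"
proof (induction v)
  case (Suc v)
  then show ?case
    using arcs_path_zddI[of v N One] by (auto intro: rtrancl_into_rtrancl)
qed simp

lemma is_zdd_path_zdd: "is_zdd (path_zdd N)"
proof -
  have "(Branch 0, Bot) \<in> (arcs (path_zdd N))\<^sup>*"
    using arcs_path_zddI[of 0 N Zero] by auto
  moreover have "(Branch 0, Top) \<in> (arcs (path_zdd N))\<^sup>*"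
    using arcs_path_zddI[of N N One] reachable_path_zdd[of N N]
    by (auto intro: rtrancl_into_rtrancl)
  moreover have "target (path_zdd N) (v, b) \<in> nodes (path_zdd N) \<and>
      Suc v < level (path_zdd N) (target (path_zdd N) (v, b))" if "v \<le> N" for v b
    using that by (cases b) (auto simp: nodes_def)
  ultimately show ?thesis
    unfolding is_zdd_def by (auto simp: nodes_def edges_def reachable_path_zdd)
qed

lemma card_nodes_path_zdd: "card (nodes (path_zdd N)) = N + 3"
proof -
  have "card (Branch ` {..N}) = Suc N"
    by (subst card_image) (auto simp: inj_on_def)
  moreover have "Bot \<notin> Branch ` {..N}" "Top \<notin> Branch ` {..N}" by auto
  ultimately show ?thesis by (simp add: nodes_def)
qed

section \<open>Its spanning tree and complement edges\<close>

primrec path_tree :: "nat \<Rightarrow> nat \<Rightarrow> (nat, nat edge) otree" where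
  "path_tree s 0 = ONode s []"
| "path_tree s (Suc n) = ONode s [((s, One), path_tree (Suc s) n)]"

text \<open>On entering \<open>v\<close> exactly the smaller nodes have been visited, so the 1-edge
  always leads to a fresh node, while the 0-edge ends in \<open>Bot\<close> and adds
  nothing.\<close>

lemma dfs_path_zdd:
  "v + m = N \<Longrightarrow> dfs (path_zdd N) (Suc m) v {..<v} = (path_tree v m, {..N})"
proof (induction m arbitrary: v)
  case (Suc m)
  have "insert v {..<v} = {..<Suc v}" by auto
  with Suc.IH[of "Suc v"] Suc.prems show ?case
    by (simp add: follow_def del: dfs.simps(2) add: dfs.simps(2)[of _ "Suc m"])
next
  case 0
  then show ?case by (auto simp: follow_def)
qed

lemma spanning_tree_path_zdd: "spanning_tree (path_zdd N) = path_tree 0 N"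
  using dfs_path_zdd[of 0 N N] by (simp add: spanning_tree_def del: dfs.simps)

lemma tree_edges_path_tree: "tree_edges (path_tree s n) = {s..<s + n} \<times> {One}"
  by (induction n arbitrary: s) auto

lemma preorder_path_tree: "preorder (path_tree s n) = [s..<s + Suc n]"
  by (induction n arbitrary: s) (simp_all add: upt_conv_Cons del: upt_Suc)

text \<open>Node \<open>N\<close> is the only one that keeps both of its edges; this sets the last
  leaf of the top tree apart.\<close>

lemma complement_edges_path_zdd:
  "complement_edges (path_zdd N) = insert (N, One) ({..N} \<times> {Zero})"
proof -
  have "b = Zero \<or> b = One" for b by (cases b) auto
  then show ?thesis
    unfolding complement_edges_def spanning_tree_path_zdd tree_edges_path_tree edges_def
    by auto
qed

lemma parent_edge_path_zdd:
  assumes "v < N" shows "parent_edge (path_zdd N) (Suc v) = (v, One)"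
  unfolding parent_edge_def spanning_tree_path_zdd tree_edges_path_tree
    target_path_zdd_eq_Branch
  using assms by (intro the_equality) auto

section \<open>Greedy contraction of a path\<close>

primrec block :: "nat \<Rightarrow> nat \<Rightarrow> nat vertex" where
  "block 0 a = Leaf (a, One)"
| "block (Suc h) a = Node V (block h a) (block h (a + 2 ^ h))"

text \<open>The state of the contraction after \<open>h\<close> rounds. Surviving nodes keep their
  original names, hence the stride \<open>2 ^ h\<close>.\<close>

primrec block_path :: "nat \<Rightarrow> nat \<Rightarrow> nat \<Rightarrow> (nat, nat edge) ctree" where
  "block_path h s 0 = ONode s []"
| "block_path h s (Suc n) = ONode s [(block h s, block_path h (s + 2 ^ h) n)]"

lemma map_path_tree: "map_otree id Leaf (path_tree s n) = block_path 0 s n"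
  by (induction n arbitrary: s) auto

lemma chain_block_path: "chain (block_path h s n) = n"
  by (induction n arbitrary: s) auto

text \<open>Only children are never merged horizontally. As the length is even, an odd number of
  edges lies below the top edge, so pairing from the bottom uses up the whole path.\<close>

lemma greedy_round_block_path:
  "greedy_round (block_path h s (2 * n)) = block_path (Suc h) s n"
proof (induction n arbitrary: s)
  case (Suc n)
  have eq: "s + 2 ^ h + 2 ^ h = s + 2 ^ Suc h" by simp
  show ?case by (simp add: chain_block_path Suc.IH eq del: power_Suc)
qed simp

lemma single_edge_block_path: "single_edge (block_path h s n) \<longleftrightarrow> n = 1"
proof (cases n)
  case (Suc m)
  then show ?thesis by (cases m) auto
qed simp

text \<open>Induction on the number \<open>i\<close> of remaining rounds: each round halves the
  length and raises the height \<open>h\<close> by one.\<close>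

lemma contract_block_path:
  "first_edge (while (\<lambda>t. \<not> single_edge t) greedy_round (block_path h s (2 ^ i)))
    = block (h + i) s"
proof (induction i arbitrary: h)
  case 0
  then show ?case by (subst while_unfold) (simp add: single_edge_block_path[of h s 1, simplified])
next
  case (Suc i)
  have "\<not> single_edge (block_path h s (2 ^ Suc i))" by (simp add: single_edge_block_path)
  then have "while (\<lambda>t. \<not> single_edge t) greedy_round (block_path h s (2 ^ Suc i))
      = while (\<lambda>t. \<not> single_edge t) greedy_round (block_path (Suc h) s (2 ^ i))"
    by (subst while_unfold) (simp add: greedy_round_block_path)
  with Suc.IH[of "Suc h"] show ?case by simp
qed

lemma top_tree_path_zdd: "top_tree (path_zdd (2 ^ k)) = block k 0"
  using contract_block_path[of 0 0 k]
  by (simp add: top_tree_def greedy_top_tree_def spanning_tree_path_zdd map_path_tree)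

lemma block_eq_height: "block h a = block h' b \<Longrightarrow> h = h'"
proof (induction h arbitrary: a b h')
  case 0
  then show ?case by (cases h') auto
next
  case (Suc h)
  then show ?case by (cases h') auto
qed

text \<open>All complement edges end in terminals, so the \<open>lca\<close> case never
  arises.\<close>

lemma store_at_path_zdd:
  assumes "e \<in> complement_edges (path_zdd N)" "fst e = Suc v"
  shows "store_at (path_zdd N) e = Leaf (v, One)"
proof -
  from assms have "v < N" by (auto simp: complement_edges_path_zdd)
  moreover from assms have "target (path_zdd N) e \<in> {Bot, Top}"
    by (auto simp: complement_edges_path_zdd)
  ultimately show ?thesis
    using assms by (auto simp: store_at_def parent_edge_path_zdd)
qed

lemma store_at_path_zdd_cases:
  assumes "e \<in> complement_edges (path_zdd N)"
  obtains "fst e = 0" "store_at (path_zdd N) e = top_tree (path_zdd N)"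
  | v where "fst e = Suc v" "store_at (path_zdd N) e = Leaf (v, One)"
  using assms store_at_path_zdd by (cases "fst e") (auto simp: store_at_def)

text \<open>Complement edges go to leaves or, if they leave node 0, to the root of the top tree,
  which has height \<open>k\<close>.\<close>

lemma stored_block:
  assumes "Suc h < k"
  shows "stored (path_zdd (2 ^ k)) (block (Suc h) a) = {}"
proof -
  have "store_at (path_zdd (2 ^ k)) e \<noteq> block (Suc h) a"
    if "e \<in> complement_edges (path_zdd (2 ^ k))" for e
    using that
  proof (cases rule: store_at_path_zdd_cases)
    case 1
    with assms block_eq_height show ?thesis unfolding top_tree_path_zdd by (metis nat_neq_iff)
  qed simp
  then show ?thesis by (auto simp: stored_def)
qed

text \<open>The rank does not depend on \<open>i\<close>, which makes the triples of different
  leaves comparable.\<close>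

lemma local_preorder_leaf:
  assumes "i < N"
  shows "local_preorder (path_zdd N) (Leaf (i, One)) (Suc i) = 2"
proof -
  \<comment> \<open>Of the nodes preceding \<open>Suc i\<close> in preorder, only \<open>i\<close>
    lies in the cluster.\<close>
  have "[0..<Suc N] = [0..<i] @ i # Suc i # [Suc (Suc i)..<Suc N]"
    using assms upt_add_eq_append[of 0 i "Suc N - i"]
    by (simp add: upt_conv_Cons del: upt_Suc)
  moreover have "takeWhile (\<lambda>w. w \<noteq> Suc i) ([0..<i] @ i # Suc i # ys) = [0..<i] @ [i]" for ys
    by (subst takeWhile_append2) auto
  moreover have "cluster_nodes (path_zdd N) (Leaf (i, One)) = {i, Suc i}"
    using assms by (auto simp: cluster_nodes_def)
  ultimately show ?thesis
    by (simp add: local_preorder_def spanning_tree_path_zdd preorder_path_tree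
        filter_empty_conv del: upt_Suc)
qed

text \<open>The hypothesis excludes the last leaf, which also stores the 1-edge to
  \<open>Top\<close>.\<close>

lemma stored_leaf:
  assumes "Suc i < 2 ^ k"
  shows "stored (path_zdd (2 ^ k)) (Leaf (i, One)) = {((2, Bot), Zero, Bot)}"
proof -
  let ?G = "path_zdd (2 ^ k)"
  \<comment> \<open>A leaf that is itself the root would also receive the complement edge of node
    0.\<close>
  from assms have "k \<noteq> 0" by (cases k) auto
  then have top: "top_tree ?G \<noteq> Leaf (i, One)"
    unfolding top_tree_path_zdd by (cases k) auto
  have "{e \<in> complement_edges ?G. store_at ?G e = Leaf (i, One)} = {(Suc i, Zero)}"
  proof (intro equalityI subsetI)
    fix e assume "e \<in> {e \<in> complement_edges ?G. store_at ?G e = Leaf (i, One)}"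
    then have e: "e \<in> complement_edges ?G" and st: "store_at ?G e = Leaf (i, One)" by auto
    from e st top have "fst e = Suc i" by (cases rule: store_at_path_zdd_cases) auto
    with e assms show "e \<in> {(Suc i, Zero)}" by (auto simp: complement_edges_path_zdd)
  next
    fix e assume "e \<in> {(Suc i, Zero)}"
    moreover have "(Suc i, Zero) \<in> complement_edges ?G"
      using assms by (simp add: complement_edges_path_zdd)
    ultimately show "e \<in> {e \<in> complement_edges ?G. store_at ?G e = Leaf (i, One)}"
      using store_at_path_zdd[of "(Suc i, Zero)" "2 ^ k" i] by auto
  qed
  with assms show ?thesis
    by (simp add: stored_def triple_def local_preorder_leaf edge_label_def)
qed

text \<open>The strict bounds keep both blocks clear of the last leaf. All other leaves carry label
  difference -1 and the same triple, and inner vertices of these blocks store nothing.\<close>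

lemma labelled_block:
  assumes "h < k" "a + 2 ^ h < 2 ^ k" "b + 2 ^ h < 2 ^ k"
  shows "labelled (path_zdd (2 ^ k)) (block h a) = labelled (path_zdd (2 ^ k)) (block h b)"
  using assms
proof (induction h arbitrary: a b)
  case 0
  then show ?case by (simp add: stored_leaf edge_label_def)
next
  case (Suc h)
  have "labelled (path_zdd (2 ^ k)) (block h a) = labelled (path_zdd (2 ^ k)) (block h b)"
    "labelled (path_zdd (2 ^ k)) (block h (a + 2 ^ h))
      = labelled (path_zdd (2 ^ k)) (block h (b + 2 ^ h))"
    using Suc.prems by (intro Suc.IH; simp)+
  with Suc.prems(1) show ?case
    using stored_block[of h k] by simp
qed

section \<open>Counting the classes of vertices\<close>

lemma subtrees_blockE:
  assumes "s \<in> subtrees (block h a)"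
  obtains j b where "j \<le> h" "s = block j b" "a \<le> b" "b + 2 ^ j \<le> a + 2 ^ h"
  using assms
proof (induction h arbitrary: a thesis)
  case 0
  then show ?case by auto
next
  case (Suc h)
  from Suc.prems(2) consider "s = block (Suc h) a" | "s \<in> subtrees (block h a)"
    | "s \<in> subtrees (block h (a + 2 ^ h))" by auto
  then show ?case
  proof cases
    case 1
    then show ?thesis using Suc.prems(1) by blast
  next
    case 2
    then obtain j b where "j \<le> h" "s = block j b" "a \<le> b" "b + 2 ^ j \<le> a + 2 ^ h"
      using Suc.IH by metis
    then show ?thesis by (intro Suc.prems(1)[of j b]) auto
  next
    case 3
    then obtain j b where
      "j \<le> h" "s = block j b" "a + 2 ^ h \<le> b" "b + 2 ^ j \<le> a + 2 ^ h + 2 ^ h"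
      using Suc.IH by metis
    then show ?thesis by (intro Suc.prems(1)[of j b]) auto
  qed
qed

lemma card_labelled_subtrees:
  "card (labelled (path_zdd (2 ^ k)) ` subtrees (block k 0)) \<le> 2 * Suc k"
proof -
  let ?L = "labelled (path_zdd (2 ^ k))"
  \<comment> \<open>\<open>?A\<close> represents the blocks avoiding the last leaf by the leftmost
    ones; \<open>?B\<close> holds the only block of each height that ends in it. For
    \<open>j = k\<close> both give the root.\<close>
  let ?A = "(\<lambda>j. ?L (block j 0)) ` {..k}"
  let ?B = "(\<lambda>j. ?L (block j (2 ^ k - 2 ^ j))) ` {..k}"
  have "?L s \<in> ?A \<union> ?B" if "s \<in> subtrees (block k 0)" for s
  proof -
    from that obtain j b where j: "j \<le> k" "s = block j b" and "b + 2 ^ j \<le> 2 ^ k"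
      by (auto elim: subtrees_blockE)
    then consider "b + 2 ^ j < 2 ^ k" | "b = 2 ^ k - 2 ^ j" by fastforce
    then show ?thesis
    proof cases
      case 1
      then have "(2::nat) ^ j < 2 ^ k" by (rule le_less_trans[rotated]) simp
      moreover from this have "j < k" by simp
      ultimately have "?L s = ?L (block j 0)"
        unfolding j(2) using 1 by (intro labelled_block) auto
      with j(1) show ?thesis by auto
    qed (use j in auto)
  qed
  then have "card (?L ` subtrees (block k 0)) \<le> card (?A \<union> ?B)"
    by (intro card_mono) auto
  also have "\<dots> \<le> card ?A + card ?B" by (rule card_Un_le)
  also have "\<dots> \<le> Suc k + Suc k"
    by (intro add_mono order.trans[OF card_image_le]) auto
  finally show ?thesis by simp
qed

lemma finite_subtrees: "finite (subtrees t)"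
  by (induction t) auto

text \<open>The classes of \<open>dag_rel G\<close> are the fibres of \<open>labelled G\<close> on
  the subtrees.\<close>

lemma card_vertices_top_zdd_of:
  "card (vertices (top_zdd_of G)) \<le> card (labelled G ` subtrees (top_tree G))"
proof -
  let ?S = "subtrees (top_tree G)"
  have "vertices (top_zdd_of G) = (\<lambda>y. {t \<in> ?S. y = labelled G t}) ` labelled G ` ?S"
    unfolding top_zdd_of_def quotient_def dag_rel_def by (auto simp: image_image)
  then show ?thesis by (simp add: card_image_le finite_subtrees)
qed

lemma card_vertices_path_zdd:
  "card (vertices (top_zdd_of (path_zdd (2 ^ k)))) \<le> 2 * Suc k"
  using card_vertices_top_zdd_of[of "path_zdd (2 ^ k)"] card_labelled_subtrees[of k]
  by (simp add: top_tree_path_zdd)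

section \<open>The logarithmic bound\<close>

theorem theorem6:
  shows "\<exists>K::real. K > 0 \<and>
    infinite {n::nat. n > 0 \<and>
      (\<exists>G :: nat zdd. is_zdd G \<and> card (branching G) \<ge> 2 \<and> card (nodes G) = n \<and>
        real (card (vertices (top_zdd_of G))) \<le> K * ln (real n))}"
proof (intro exI[of _ 8] conjI)
  let ?M = "{n::nat. n > 0 \<and>
      (\<exists>G :: nat zdd. is_zdd G \<and> card (branching G) \<ge> 2 \<and> card (nodes G) = n \<and>
        real (card (vertices (top_zdd_of G))) \<le> 8 * ln (real n))}"
  \<comment> \<open>The constant 8 comes from 2(k + 2) \<le> 4(k + 1) and ln 2 \<ge> 1/2. Exponents
    start at 1 because ln (2 ^ 0) = 0 could not bound the positive number of vertices.\<close>
  have "2 ^ Suc k + 3 \<in> ?M" for k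
  proof -
    let ?G = "path_zdd (2 ^ Suc k)"
    have "real (card (vertices (top_zdd_of ?G))) \<le> 2 * (real k + 2)"
      using of_nat_mono[OF card_vertices_path_zdd[of "Suc k"], where ?'a = real] by simp
    also have "\<dots> \<le> 8 * (real (Suc k) * (1 / 2))" by simp
    also have "\<dots> \<le> 8 * (real (Suc k) * ln 2)"
      using exp_half_le2 ln_ge_iff[of 2 "1 / 2"] by (intro mult_left_mono) simp_all
    also have "real (Suc k) * ln 2 = ln (2 ^ Suc k)" by (simp only: ln_realpow)
    also have "8 * \<dots> \<le> 8 * ln (real (2 ^ Suc k + 3))" by (simp add: add_pos_pos)
    finally show ?thesis
      using is_zdd_path_zdd[of "2 ^ Suc k"] card_nodes_path_zdd[of "2 ^ Suc k"] by auto
  qed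
  then have "range (\<lambda>k::nat. 2 ^ Suc k + 3) \<subseteq> ?M" by (intro image_subsetI)
  moreover have "infinite (range (\<lambda>k::nat. 2 ^ Suc k + 3 :: nat))"
    by (simp add: finite_image_iff inj_on_def)
  ultimately show "infinite ?M" by (rule infinite_super)
qed simp

end
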